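(* Let $0<b<c$, and let the LASER algorithm with parameters $b,c$ be run on a sequence $(\mathbf x_1,y_1),\dots,(\mathbf x_T,y_T)\in\mathbb R^d\times\mathbb R$. Assume that $\sup_t|y_t|\le Y$ for some $Y\in\mathbb R$. Then $$L_T(\mathrm{LASER})\le\min_{\mathbf u_1,\dots,\mathbf u_T\in\mathbb R^d}\left[L_T(\{\mathbf u_t\})+c\,V_T^{(2)}(\{\mathbf u_t\})+b\|\mathbf u_1\|^2\right]+Y^2\sum_{t=1}^{T}\mathbf x_t^\top D_t^{-1}\mathbf x_t.$$
   Context: Norms are Euclidean. LASER with parameters $0<b<c$: $D_0=\frac{bc}{c-b}I\in\mathbb R^{d\times d}$, $\mathbf e_0=0\in\mathbb R^d$, and for $t\ge1$ $$D_t=\left(D_{t-1}^{-1}+c^{-1}I\right)^{-1}+\mathbf x_t\mathbf x_t^\top,\qquad \mathbf e_t=\left(I+c^{-1}D_{t-1}\right)^{-1}\mathbf e_{t-1}+y_t\mathbf x_t$$ (so $D_1=bI+\mathbf x_1\mathbf x_1^\top$, $\mathbf e_1=y_1\mathbf x_1$). Its prediction at round $t$ is $\hat y_t=\mathbf x_t^\top D_t^{-1}\left(I+c^{-1}D_{t-1}\right)^{-1}\mathbf e_{t-1}$. Notation: $L_T(\mathrm{LASER})=\sum_{t=1}^T(y_t-\hat y_t)^2$, $L_T(\{\mathbf u_t\})=\sum_{t=1}^T(y_t-\mathbf u_t^\top\mathbf x_t)^2$, $V_T^{(2)}(\{\mathbf u_t\})=\sum_{t=1}^{T-1}\|\mathbf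 u_{t+1}-\mathbf u_t\|^2$. *)

theory Defs
  imports "HOL-Analysis.Analysis"
begin

text \<open>
  Rounds are numbered from 1. A sequence is a function on the naturals whose value at 0
  is never used; an algorithm run up to round T only reads its values at 1, ..., T.
\<close>

definition outer_square :: "real ^ 'n \<Rightarrow> real ^ 'n ^ 'n" where
  "outer_square v = (\<chi> i j. v $ i * v $ j)"

primrec laser_D :: "real \<Rightarrow> real \<Rightarrow> (nat \<Rightarrow> real ^ 'n) \<Rightarrow> nat \<Rightarrow> real ^ 'n ^ 'n" where
  "laser_D b c x 0 = (b * c / (c - b)) *\<^sub>R mat 1"
| "laser_D b c x (Suc t) =
     matrix_inv (matrix_inv (laser_D b c x t) + inverse c *\<^sub>R mat 1) + outer_square (x (Suc t))"

primrec laser_e ::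
  "real \<Rightarrow> real \<Rightarrow> (nat \<Rightarrow> real ^ 'n) \<Rightarrow> (nat \<Rightarrow> real) \<Rightarrow> nat \<Rightarrow> real ^ 'n" where
  "laser_e b c x y 0 = 0"
| "laser_e b c x y (Suc t) =
     matrix_inv (mat 1 + inverse c *\<^sub>R laser_D b c x t) *v laser_e b c x y t
       + y (Suc t) *\<^sub>R x (Suc t)"

text \<open>The prediction is meaningful for rounds \<open>t \<ge> 1\<close> only, because of the index \<open>t - 1\<close>.\<close>

definition laser_pred ::
  "real \<Rightarrow> real \<Rightarrow> (nat \<Rightarrow> real ^ 'n) \<Rightarrow> (nat \<Rightarrow> real) \<Rightarrow> nat \<Rightarrow> real" where
  "laser_pred b c x y t =
     x t \<bullet> (matrix_inv (laser_D b c x t) *v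
       (matrix_inv (mat 1 + inverse c *\<^sub>R laser_D b c x (t - 1)) *v laser_e b c x y (t - 1)))"

definition laser_loss ::
  "real \<Rightarrow> real \<Rightarrow> (nat \<Rightarrow> real ^ 'n) \<Rightarrow> (nat \<Rightarrow> real) \<Rightarrow> nat \<Rightarrow> real" where
  "laser_loss b c x y T = (\<Sum>t = 1..T. (y t - laser_pred b c x y t)\<^sup>2)"

definition comparator_loss ::
  "(nat \<Rightarrow> real ^ 'n) \<Rightarrow> (nat \<Rightarrow> real) \<Rightarrow> (nat \<Rightarrow> real ^ 'n) \<Rightarrow> nat \<Rightarrow> real" where
  "comparator_loss x y u T = (\<Sum>t = 1..T. (y t - u t \<bullet> x t)\<^sup>2)"

definition total_drift :: "(nat \<Rightarrow> real ^ 'n) \<Rightarrow> nat \<Rightarrow> real" where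
  "total_drift u T = (\<Sum>t = 1..T - 1. (norm (u (Suc t) - u t))\<^sup>2)"

definition comparator_cost ::
  "real \<Rightarrow> real \<Rightarrow> (nat \<Rightarrow> real ^ 'n) \<Rightarrow> (nat \<Rightarrow> real) \<Rightarrow> nat \<Rightarrow> (nat \<Rightarrow> real ^ 'n) \<Rightarrow> real" where
  "comparator_cost b c x y T u =
     comparator_loss x y u T + c * total_drift u T + b * (norm (u 1))\<^sup>2"

end

theory Submission
  imports Defs
begin

text \<open>
  The cheapest comparator ending in \<open>w\<close> at round \<open>t\<close> costs
  \<open>q\<^sub>t w = w \<bullet> D\<^sub>t w - 2 w \<bullet> e\<^sub>t + f\<^sub>t\<close>: the LASER recursion is the dynamic programming
  recursion for this quadratic, obtained by minimising \<open>q\<^sub>t v + c \<parallel>w - v\<parallel>\<^sup>2\<close> over \<open>v\<close> and adding the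
  new loss. The minimal cost is therefore \<open>m\<^sub>t = f\<^sub>t - e\<^sub>t \<bullet> D\<^sub>t\<inverse> e\<^sub>t\<close>, and
  the loss of a single round exceeds \<open>m\<^sub>t - m\<^sub>t\<^sub>-\<^sub>1\<close> by at most \<open>y\<^sub>t\<^sup>2 (x\<^sub>t \<bullet> D\<^sub>t\<inverse> x\<^sub>t)\<close>.
  Summing over the rounds gives the theorem.
\<close>

section \<open>Symmetric positive definite matrices and their inverses\<close>

definition posdef :: "real ^ 'n ^ 'n \<Rightarrow> bool" where
  "posdef A \<longleftrightarrow> (\<forall>u v. u \<bullet> (A *v v) = v \<bullet> (A *v u)) \<and> (\<forall>v. v \<noteq> 0 \<longrightarrow> v \<bullet> (A *v v) > 0)"

lemma posdef_sym: "posdef A \<Longrightarrow> u \<bullet> (A *v v) = v \<bullet> (A *v u)"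
  unfolding posdef_def by blast

lemma posdef_pos: "posdef A \<Longrightarrow> v \<noteq> 0 \<Longrightarrow> v \<bullet> (A *v v) > 0"
  unfolding posdef_def by blast

lemma posdef_nonneg: "posdef A \<Longrightarrow> v \<bullet> (A *v v) \<ge> 0"
  using posdef_pos[of A v] by (cases "v = 0") auto

lemma posdef_invertible:
  assumes "posdef A" shows "invertible A"
proof -
  have "\<forall>v. A *v v = 0 \<longrightarrow> v = 0"
    using posdef_pos[OF assms] by fastforce
  then show ?thesis
    by (metis invertible_left_inverse matrix_left_invertible_ker)
qed

lemma invertible_matrix_inv:
  "invertible A \<Longrightarrow> A ** matrix_inv A = mat 1 \<and> matrix_inv A ** A = mat 1"
  unfolding invertible_def matrix_inv_def by (rule someI_ex)

lemma posdef_inv_left [simp]: "posdef A \<Longrightarrow> matrix_inv A *v (A *v v) = v"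
  by (simp add: matrix_vector_mul_assoc invertible_matrix_inv posdef_invertible)

lemma posdef_inv_right [simp]: "posdef A \<Longrightarrow> A *v (matrix_inv A *v v) = v"
  by (simp add: matrix_vector_mul_assoc invertible_matrix_inv posdef_invertible)

lemma posdef_inv:
  assumes "posdef A" shows "posdef (matrix_inv A)"
  unfolding posdef_def
proof (intro conjI allI impI)
  fix u v :: "real ^ 'a"
  show "u \<bullet> (matrix_inv A *v v) = v \<bullet> (matrix_inv A *v u)"
    using posdef_sym[OF assms, of "matrix_inv A *v u" "matrix_inv A *v v"] assms
    by (simp add: inner_commute)
  assume "v \<noteq> 0"
  then have "matrix_inv A *v v \<noteq> 0"
    by (metis assms matrix_vector_mult_0_right posdef_inv_right)
  from posdef_pos[OF assms this] show "v \<bullet> (matrix_inv A *v v) > 0"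
    using assms by (simp add: inner_commute)
qed

lemma posdef_add: "posdef A \<Longrightarrow> posdef B \<Longrightarrow> posdef (A + B)"
  unfolding posdef_def
  by (auto simp: matrix_vector_mult_add_rdistrib inner_add_right intro: add_pos_pos)

lemma scaleR_mat_mult: "(k *\<^sub>R mat 1) *v v = k *\<^sub>R (v :: real ^ 'n)"
  by (simp flip: scaleR_matrix_vector_assoc)

lemma posdef_scaleR: "k > 0 \<Longrightarrow> posdef A \<Longrightarrow> posdef (k *\<^sub>R A)"
  unfolding posdef_def by (auto simp flip: scaleR_matrix_vector_assoc)

lemma posdef_mat_1: "posdef (mat 1)"
  unfolding posdef_def by (auto simp: inner_commute)

lemma outer_square_mult: "outer_square x *v v = (x \<bullet> v) *\<^sub>R x"
  by (simp add: vec_eq_iff outer_square_def matrix_vector_mult_def inner_vec_def sum_distrib_left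
      mult_ac)

lemma posdef_add_outer_square: "posdef A \<Longrightarrow> posdef (A + outer_square x)"
  unfolding posdef_def
  by (auto simp: matrix_vector_mult_add_rdistrib inner_add_right outer_square_mult inner_commute
      intro: add_pos_nonneg)

lemma inv_scaleR_mat_mult: "k > 0 \<Longrightarrow> matrix_inv (k *\<^sub>R mat 1) *v v = inverse k *\<^sub>R (v :: real ^ 'n)"
  using posdef_inv_left[OF posdef_scaleR[OF _ posdef_mat_1], of k "inverse k *\<^sub>R v"]
  by (simp add: scaleR_mat_mult)

section \<open>The drift step: completing squares and the effect on inverse quadratic forms\<close>

abbreviation parallel_sum :: "real \<Rightarrow> real ^ 'n ^ 'n \<Rightarrow> real ^ 'n ^ 'n" where
  "parallel_sum c A \<equiv> matrix_inv (matrix_inv A + inverse c *\<^sub>R mat 1)"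

text \<open>For positive definite \<open>A\<close> and \<open>c > 0\<close> this is \<open>c\<close>
  times the inverse of \<open>A + c I\<close>. It turns the stationarity equation of the drift
  minimisation into an explicit minimiser.\<close>

abbreviation shrink :: "real \<Rightarrow> real ^ 'n ^ 'n \<Rightarrow> real ^ 'n ^ 'n" where
  "shrink c A \<equiv> matrix_inv (mat 1 + inverse c *\<^sub>R A)"

lemma parallel_sum_posdef:
  assumes "c > 0" "posdef A"
  shows "posdef (matrix_inv A + inverse c *\<^sub>R mat 1)" "posdef (parallel_sum c A)"
  using assms by (simp_all add: posdef_inv posdef_add posdef_scaleR posdef_mat_1)

lemma shrink_eq:
  assumes "c > 0" "posdef A"
  shows "shrink c A *v e + inverse c *\<^sub>R (A *v (shrink c A *v e)) = e"
proof -
  have "posdef (mat 1 + inverse c *\<^sub>R A)"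
    using assms by (simp add: posdef_add posdef_scaleR posdef_mat_1)
  from posdef_inv_right[OF this, of e] show ?thesis
    by (simp add: matrix_vector_mult_add_rdistrib flip: scaleR_matrix_vector_assoc)
qed

text \<open>Applying the inverse of \<open>A\<close> plus \<open>inverse c\<close> times the
  identity to \<open>A *v s\<close>, with \<open>s = shrink c A *v w\<close>, gives the left side of
  \<open>shrink_eq\<close>, which is \<open>w\<close>.\<close>

lemma parallel_sum_eq:
  assumes "c > 0" "posdef A"
  shows "parallel_sum c A *v w = A *v (shrink c A *v w)"
proof -
  let ?s = "shrink c A *v w"
  have "(matrix_inv A + inverse c *\<^sub>R mat 1) *v (A *v ?s) = w"
    using shrink_eq[OF assms, of w] assms
    by (simp add: matrix_vector_mult_add_rdistrib scaleR_mat_mult)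
  with posdef_inv_left[OF parallel_sum_posdef(1)[OF assms], of "A *v ?s"] show ?thesis
    by simp
qed

text \<open>The left side is stationary in \<open>v\<close> when (A + c I) v = e + c w, and
  \<open>z w e\<close> solves this equation. What remains at \<open>v = z w e\<close> is a quadratic
  in \<open>w\<close> with matrix \<open>B\<close> and linear part \<open>K *v e\<close>, exactly as
  in the LASER recursion.\<close>

lemma completed_square_drift:
  fixes A :: "real ^ 'n ^ 'n"
  assumes c: "c > 0" and A: "posdef A"
  defines "K \<equiv> shrink c A" and "B \<equiv> parallel_sum c A"
  defines "z w e \<equiv> K *v w + inverse c *\<^sub>R (K *v e)"
  shows "v \<bullet> (A *v v) - 2 * (v \<bullet> e) + c * (norm (w - v))\<^sup>2 =
      (v - z w e) \<bullet> (A *v (v - z w e)) + c * (norm (v - z w e))\<^sup>2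
      + w \<bullet> (B *v w) - 2 * (w \<bullet> (K *v e)) - inverse c * (e \<bullet> (K *v e))"
proof -
  define s h d where "s = K *v w" and "h = inverse c *\<^sub>R (K *v e)" and "d = v - z w e"
  \<comment> \<open>Once the images under \<open>A\<close> are named, \<open>A\<close> enters only
    through the symmetry relations \<open>sym\<close>. Every term has the common factor
    \<open>c\<close>, so a plain inner product identity is left to check.\<close>
  define p q r where "p = inverse c *\<^sub>R (A *v d)" and "q = inverse c *\<^sub>R (A *v s)"
    and "r = inverse c *\<^sub>R (A *v h)"
  have Ad: "A *v d = c *\<^sub>R p" and As: "A *v s = c *\<^sub>R q" and Ah: "A *v h = c *\<^sub>R r"
    and g: "K *v e = c *\<^sub>R h"
    using c by (simp_all add: p_def q_def r_def h_def)
  have w: "w = s + q"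
    using shrink_eq[OF c A, of w] unfolding s_def q_def K_def by simp
  have e: "e = c *\<^sub>R h + c *\<^sub>R r"
    using shrink_eq[OF c A, of e] c unfolding K_def[symmetric] g
    by (simp add: matrix_vector_mult_scaleR flip: Ah)
  have v: "v = d + s + h"
    by (simp add: d_def z_def s_def h_def)
  have B: "B *v w = c *\<^sub>R q"
    unfolding B_def As[symmetric] s_def K_def by (rule parallel_sum_eq[OF c A])
  have sym: "s \<bullet> p = d \<bullet> q" "h \<bullet> p = d \<bullet> r" "h \<bullet> q = s \<bullet> r"
    using posdef_sym[OF A] unfolding p_def q_def r_def by simp_all
  have Av: "A *v v = c *\<^sub>R (p + q + r)"
    unfolding v by (simp add: matrix_vector_right_distrib Ad As Ah scaleR_add_right)
  have wv: "w - v = q - (d + h)"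
    unfolding v w by simp
  have comm: "p \<bullet> a = a \<bullet> p" "q \<bullet> d = d \<bullet> q" "q \<bullet> s = s \<bullet> q" "q \<bullet> h = h \<bullet> q" "r \<bullet> a = a \<bullet> r"
    "s \<bullet> d = d \<bullet> s" "h \<bullet> d = d \<bullet> h" "h \<bullet> s = s \<bullet> h" for a
    by (simp_all add: inner_commute)
  have 1: "v \<bullet> (A *v v) = c * (v \<bullet> (p + q + r))" and 2: "v \<bullet> e = c * (v \<bullet> (h + r))"
    and 3: "d \<bullet> (A *v d) = c * (d \<bullet> p)" and 4: "w \<bullet> (B *v w) = c * (w \<bullet> q)"
    and 5: "w \<bullet> (K *v e) = c * (w \<bullet> h)" and 6: "inverse c * (e \<bullet> (K *v e)) = c * ((h + r) \<bullet> h)"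
    unfolding Av Ad B g using c by (simp_all add: e inner_add_left flip: scaleR_add_right)
  have "v \<bullet> (p + q + r) - 2 * (v \<bullet> (h + r)) + (w - v) \<bullet> (w - v) =
      d \<bullet> p + d \<bullet> d + w \<bullet> q - 2 * (w \<bullet> h) - (h + r) \<bullet> h"
    unfolding wv unfolding v w
    by (simp add: inner_add_left inner_add_right inner_diff_left inner_diff_right comm sym)
  from arg_cong[OF this, of "(*) c"] show ?thesis
    unfolding d_def[symmetric] power2_norm_eq_inner 1 2 3 4 5 6
    by (simp only: distrib_left right_diff_distrib mult.left_commute[of c 2])
qed

text \<open>The inverse of the parallel sum maps \<open>g\<close> to
  \<open>matrix_inv A *v e\<close>. The subtracted term is the one by which \<open>laser_f\<close>
  drops, so the drift step alone leaves the minimal cost unchanged.\<close>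

lemma inv_parallel_sum_quadratic:
  fixes A :: "real ^ 'n ^ 'n" and e :: "real ^ 'n"
  assumes c: "c > 0" and A: "posdef A"
  defines "g \<equiv> shrink c A *v e"
  shows "g \<bullet> (matrix_inv (parallel_sum c A) *v g) = e \<bullet> (matrix_inv A *v e) - inverse c * (e \<bullet> g)"
proof -
  let ?B = "parallel_sum c A" and ?p = "matrix_inv A *v e"
  have "matrix_inv A *v (g + inverse c *\<^sub>R (A *v g)) = ?p"
    unfolding g_def shrink_eq[OF c A] ..
  then have p: "matrix_inv A *v g + inverse c *\<^sub>R g = ?p"
    using A by (simp add: matrix_vector_right_distrib matrix_vector_mult_scaleR)
  have "?B *v ?p = g"
    using posdef_inv_left[OF parallel_sum_posdef(1)[OF c A], of g] p
    by (simp add: matrix_vector_mult_add_rdistrib scaleR_mat_mult)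
  then have "matrix_inv ?B *v g = ?p"
    using posdef_inv_left[OF parallel_sum_posdef(2)[OF c A], of ?p] by simp
  moreover have "g \<bullet> ?p = (e - inverse c *\<^sub>R (A *v g)) \<bullet> ?p"
    using shrink_eq[OF c A, of e] unfolding g_def by (metis add_diff_cancel_right')
  moreover have "(A *v g) \<bullet> ?p = e \<bullet> g"
    using posdef_sym[OF A, of ?p g] A by (simp add: inner_commute)
  ultimately show ?thesis
    by (simp add: inner_diff_left)
qed

text \<open>With \<open>h = P *v g\<close> and \<open>r = x \<bullet> h\<close>, the vector
  \<open>g\<close> equals \<open>B *v h + r *\<^sub>R x\<close>. Expanding both sides, their gap is
  \<open>r\<^sup>2 * (x \<bullet> (matrix_inv B *v x))\<close>, which is nonnegative. In the
  application \<open>r\<close> is the prediction.\<close>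

lemma rank_one_update_quadratic_le:
  fixes B :: "real ^ 'n ^ 'n" and x :: "real ^ 'n"
  assumes B: "posdef B"
  defines "P \<equiv> matrix_inv (B + outer_square x)"
  shows "(x \<bullet> (P *v g))\<^sup>2 + g \<bullet> (P *v g) \<le> g \<bullet> (matrix_inv B *v g)"
proof -
  define h r where "h = P *v g" and "r = x \<bullet> h"
  have g: "g = B *v h + r *\<^sub>R x"
    using posdef_inv_right[OF posdef_add_outer_square[OF B], of x g]
    by (simp add: P_def[symmetric] h_def[symmetric] r_def matrix_vector_mult_add_rdistrib
        outer_square_mult)
  have *: "(B *v h) \<bullet> (matrix_inv B *v x) = r"
    using posdef_sym[OF B, of "matrix_inv B *v x" h] B by (simp add: r_def inner_commute)
  have "g \<bullet> (matrix_inv B *v g) = h \<bullet> (B *v h) + 2 * r\<^sup>2 + r\<^sup>2 * (x \<bullet> (matrix_inv B *v x))"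
    unfolding g using B *
    by (simp add: matrix_vector_right_distrib matrix_vector_mult_scaleR inner_add_left
        inner_add_right power2_eq_square algebra_simps r_def inner_commute)
  moreover have "g \<bullet> h = h \<bullet> (B *v h) + r\<^sup>2"
    unfolding g by (simp add: inner_add_left inner_add_right r_def inner_commute power2_eq_square)
  moreover have "x \<bullet> (matrix_inv B *v x) \<ge> 0"
    by (intro posdef_nonneg posdef_inv B)
  ultimately show ?thesis
    by (simp add: h_def[symmetric] r_def[symmetric])
qed

section \<open>The LASER matrices and the dynamic programming recursion for the comparator
  cost\<close>

lemma laser_D_posdef:
  assumes "0 < b" "b < c" shows "posdef (laser_D b c x t)"
proof (induction t)
  case 0
  then show ?case using assms by (simp add: posdef_scaleR posdef_mat_1)
next
  case (Suc t)
  then show ?case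
    using assms by (simp add: posdef_add_outer_square parallel_sum_posdef)
qed

text \<open>The initial scale is chosen so that (c - b)/(b c) + 1/c = 1/b. The first drift step
  therefore yields \<open>b\<close> times the identity, which encodes the penalty on the first
  comparator vector.\<close>

lemma laser_D_1:
  assumes "0 < b" "b < c"
  shows "laser_D b c x (Suc 0) *v w = b *\<^sub>R w + (x (Suc 0) \<bullet> w) *\<^sub>R x (Suc 0)"
proof -
  let ?k = "b * c / (c - b)"
  let ?A = "?k *\<^sub>R mat 1 :: real ^ 'a ^ 'a"
  have k: "?k > 0" using assms by simp
  have "posdef ?A" by (intro posdef_scaleR posdef_mat_1 k)
  then have pd: "posdef (matrix_inv ?A + inverse c *\<^sub>R mat 1)"
    using assms by (intro parallel_sum_posdef) auto
  have "inverse ?k * b + inverse c * b = 1"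
    using assms by (simp add: field_simps)
  then have "(matrix_inv ?A + inverse c *\<^sub>R mat 1) *v (b *\<^sub>R w) = w"
    using inv_scaleR_mat_mult[OF k, of "b *\<^sub>R w"]
    by (simp add: matrix_vector_mult_add_rdistrib scaleR_mat_mult flip: scaleR_add_left)
  with posdef_inv_left[OF pd, of "b *\<^sub>R w"] have "parallel_sum c ?A *v w = b *\<^sub>R w"
    by simp
  then show ?thesis
    by (simp add: matrix_vector_mult_add_rdistrib outer_square_mult)
qed

text \<open>The constant term of the quadratic: each round adds the constant left over in
  \<open>completed_square_drift\<close> and the constant of the new squared loss.\<close>

primrec laser_f ::
  "real \<Rightarrow> real \<Rightarrow> (nat \<Rightarrow> real ^ 'n) \<Rightarrow> (nat \<Rightarrow> real) \<Rightarrow> nat \<Rightarrow> real" where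
  "laser_f b c x y 0 = 0"
| "laser_f b c x y (Suc t) = laser_f b c x y t
     - inverse c * (laser_e b c x y t \<bullet> (shrink c (laser_D b c x t) *v laser_e b c x y t))
     + (y (Suc t))\<^sup>2"

definition optimal_cost_at ::
  "real \<Rightarrow> real \<Rightarrow> (nat \<Rightarrow> real ^ 'n) \<Rightarrow> (nat \<Rightarrow> real) \<Rightarrow> nat \<Rightarrow> real ^ 'n \<Rightarrow> real" where
  "optimal_cost_at b c x y t w =
     w \<bullet> (laser_D b c x t *v w) - 2 * (w \<bullet> laser_e b c x y t) + laser_f b c x y t"

definition optimal_cost ::
  "real \<Rightarrow> real \<Rightarrow> (nat \<Rightarrow> real ^ 'n) \<Rightarrow> (nat \<Rightarrow> real) \<Rightarrow> nat \<Rightarrow> real" where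
  "optimal_cost b c x y t = laser_f b c x y t
     - laser_e b c x y t \<bullet> (matrix_inv (laser_D b c x t) *v laser_e b c x y t)"

text \<open>The excess over the optimum is the nonnegative square from
  \<open>completed_square_drift\<close>, which vanishes at \<open>z\<close>. The inequality gives
  the lower bound on comparator costs, the equality lets an optimal comparator be built.\<close>

lemma optimal_cost_at_Suc:
  assumes "0 < b" "b < c"
  obtains z where
    "\<And>v. optimal_cost_at b c x y (Suc t) w \<le>
       optimal_cost_at b c x y t v + c * (norm (w - v))\<^sup>2 + (y (Suc t) - w \<bullet> x (Suc t))\<^sup>2"
    "optimal_cost_at b c x y (Suc t) w =
       optimal_cost_at b c x y t z + c * (norm (w - z))\<^sup>2 + (y (Suc t) - w \<bullet> x (Suc t))\<^sup>2"
proof -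
  let ?A = "laser_D b c x t" and ?e = "laser_e b c x y t"
  have c: "c > 0" and A: "posdef ?A"
    using assms by (auto intro: laser_D_posdef)
  define z where "z = shrink c ?A *v w + inverse c *\<^sub>R (shrink c ?A *v ?e)"
  have eq: "optimal_cost_at b c x y t v + c * (norm (w - v))\<^sup>2 + (y (Suc t) - w \<bullet> x (Suc t))\<^sup>2 =
      optimal_cost_at b c x y (Suc t) w + ((v - z) \<bullet> (?A *v (v - z)) + c * (norm (v - z))\<^sup>2)" for v
    using completed_square_drift[OF c A, of v ?e w] unfolding z_def[symmetric]
    by (simp add: optimal_cost_at_def matrix_vector_mult_add_rdistrib inner_add_right
        outer_square_mult inner_commute[of "x (Suc t)" w] power2_eq_square algebra_simps)
  have nonneg: "0 \<le> (v - z) \<bullet> (?A *v (v - z)) + c * (norm (v - z))\<^sup>2" for v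
    using c A by (simp add: posdef_nonneg)
  show thesis
  proof (rule that)
    show "optimal_cost_at b c x y (Suc t) w \<le>
       optimal_cost_at b c x y t v + c * (norm (w - v))\<^sup>2 + (y (Suc t) - w \<bullet> x (Suc t))\<^sup>2" for v
      unfolding eq using nonneg[of v] by linarith
    show "optimal_cost_at b c x y (Suc t) w =
       optimal_cost_at b c x y t z + c * (norm (w - z))\<^sup>2 + (y (Suc t) - w \<bullet> x (Suc t))\<^sup>2"
      unfolding eq by simp
  qed
qed

text \<open>Passing from 0 to 1 rounds is excluded: both drift sums are then empty, so no term
  comparing \<open>v 1\<close> with \<open>v 0\<close> appears.\<close>

lemma comparator_cost_Suc:
  assumes "t \<ge> 1"
  shows "comparator_cost b c x y (Suc t) v = comparator_cost b c x y t v
    + c * (norm (v (Suc t) - v t))\<^sup>2 + (y (Suc t) - v (Suc t) \<bullet> x (Suc t))\<^sup>2"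
proof -
  obtain n where "t = Suc n" using assms by (cases t) auto
  then show ?thesis
    by (simp add: comparator_cost_def comparator_loss_def total_drift_def algebra_simps)
qed

lemma comparator_cost_1:
  assumes "0 < b" "b < c"
  shows "comparator_cost b c x y (Suc 0) v = optimal_cost_at b c x y (Suc 0) (v (Suc 0))"
  using laser_D_1[OF assms, of x "v (Suc 0)"]
  unfolding comparator_cost_def power2_norm_eq_inner
  by (simp add: comparator_loss_def total_drift_def optimal_cost_at_def
      inner_add_right power2_eq_square inner_commute algebra_simps
      del: laser_D.simps)

lemma comparator_cost_ge:
  assumes "0 < b" "b < c" "t \<ge> 1"
  shows "optimal_cost_at b c x y t (v t) \<le> comparator_cost b c x y t v"
  using assms(3)
proof (induction t rule: nat_induct_at_least)
  case base
  show ?case using comparator_cost_1[OF assms(1,2), of x y v] by simp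
next
  case (Suc t)
  then show ?case
    using optimal_cost_at_Suc[OF assms(1,2), of x y t "v (Suc t)"] comparator_cost_Suc[of t b c x y v]
    by (smt (verit))
qed

text \<open>An optimal sequence is built backwards: the minimiser \<open>z\<close> becomes the
  endpoint required one round earlier, hence the induction for arbitrary \<open>w\<close>.\<close>

lemma comparator_cost_attained:
  assumes "0 < b" "b < c" "t \<ge> 1"
  shows "\<exists>v. v t = w \<and> comparator_cost b c x y t v = optimal_cost_at b c x y t w"
  using assms(3)
proof (induction t arbitrary: w rule: nat_induct_at_least)
  case base
  then show ?case using comparator_cost_1[OF assms(1,2), of x y "\<lambda>_. w"] by auto
next
  case (Suc t)
  obtain z where z: "optimal_cost_at b c x y (Suc t) w =
      optimal_cost_at b c x y t z + c * (norm (w - z))\<^sup>2 + (y (Suc t) - w \<bullet> x (Suc t))\<^sup>2"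
    using optimal_cost_at_Suc[OF assms(1,2)] by blast
  obtain v where v: "v t = z" "comparator_cost b c x y t v = optimal_cost_at b c x y t z"
    using Suc.IH by blast
  \<comment> \<open>Since \<open>t \<ge> 1\<close>, the cost up to \<open>t\<close> reads only
    indices 1 to \<open>t\<close>, including those in the drift and the penalty.\<close>
  have "comparator_cost b c x y t (v(Suc t := w)) = comparator_cost b c x y t v"
    using Suc.hyps unfolding comparator_cost_def comparator_loss_def total_drift_def
    by (intro arg_cong2[where f = "(+)"] arg_cong2[where f = "(*)"] sum.cong) auto
  then show ?case
    using z v comparator_cost_Suc[OF Suc.hyps, of b c x y "v(Suc t := w)"]
    by (intro exI[of _ "v(Suc t := w)"]) (simp del: fun_upd_apply add: fun_upd_same fun_upd_other)
qed

section \<open>Minimisation over the last comparator vector\<close>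

lemma completed_square_quadratic:
  assumes A: "posdef A"
  shows "w \<bullet> (A *v w) - 2 * (w \<bullet> e) =
    (w - matrix_inv A *v e) \<bullet> (A *v (w - matrix_inv A *v e)) - e \<bullet> (matrix_inv A *v e)"
proof -
  let ?p = "matrix_inv A *v e"
  have "?p \<bullet> (A *v w) = w \<bullet> e" "?p \<bullet> e = e \<bullet> ?p"
    using posdef_sym[OF A, of ?p w] A by (simp_all add: inner_commute)
  then show ?thesis
    using A by (simp add: matrix_vector_mult_diff_distrib inner_diff_left inner_diff_right)
qed

lemma optimal_cost_attained:
  assumes "0 < b" "b < c"
  shows "\<exists>u. comparator_cost b c x y T u = optimal_cost b c x y T \<and>
    (\<forall>v. optimal_cost b c x y T \<le> comparator_cost b c x y T v)"
proof (cases "T = 0")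
  case True
  \<comment> \<open>With no rounds the cost is still \<open>b * (norm (u 1))\<^sup>2\<close>, so the
    zero sequence attains the minimum 0.\<close>
  then show ?thesis
    using assms by (intro exI[of _ "\<lambda>_. 0"])
      (auto simp: comparator_cost_def comparator_loss_def total_drift_def optimal_cost_def)
next
  case False
  then have T: "T \<ge> 1" by simp
  let ?A = "laser_D b c x T" and ?e = "laser_e b c x y T"
  let ?p = "matrix_inv ?A *v ?e"
  have A: "posdef ?A" using assms by (rule laser_D_posdef)
  have eq: "optimal_cost_at b c x y T w = optimal_cost b c x y T + (w - ?p) \<bullet> (?A *v (w - ?p))" for w
    using completed_square_quadratic[OF A, of w ?e] unfolding optimal_cost_at_def optimal_cost_def
    by simp
  have "optimal_cost b c x y T \<le> optimal_cost_at b c x y T w" for w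
    using eq posdef_nonneg[OF A] by simp
  then have "optimal_cost b c x y T \<le> comparator_cost b c x y T v" for v
    using comparator_cost_ge[OF assms T, of x y v] order_trans by blast
  moreover have "optimal_cost_at b c x y T ?p = optimal_cost b c x y T"
    using eq[of ?p] by simp
  ultimately show ?thesis
    using comparator_cost_attained[OF assms T, of ?p x y] by metis
qed

section \<open>The loss of LASER against the growth of the optimal cost\<close>

lemma laser_round_loss:
  assumes "0 < b" "b < c"
  shows "(y (Suc t) - laser_pred b c x y (Suc t))\<^sup>2 \<le>
    optimal_cost b c x y (Suc t) - optimal_cost b c x y t
    + (y (Suc t))\<^sup>2 * (x (Suc t) \<bullet> (matrix_inv (laser_D b c x (Suc t)) *v x (Suc t)))"
proof -
  let ?A = "laser_D b c x t" and ?e = "laser_e b c x y t" and ?D = "laser_D b c x (Suc t)"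
  let ?x = "x (Suc t)" and ?y = "y (Suc t)" and ?B = "parallel_sum c ?A"
  define g where "g = shrink c ?A *v ?e"
  have c: "c > 0" and A: "posdef ?A" and D: "posdef ?D"
    using assms laser_D_posdef[OF assms] by (auto simp del: laser_D.simps)
  have "(?x \<bullet> (matrix_inv ?D *v g))\<^sup>2 + g \<bullet> (matrix_inv ?D *v g)
      \<le> ?e \<bullet> (matrix_inv ?A *v ?e) - inverse c * (?e \<bullet> g)"
    using rank_one_update_quadratic_le[OF parallel_sum_posdef(2)[OF c A], of ?x g]
      inv_parallel_sum_quadratic[OF c A, of ?e]
    by (simp add: g_def)
  moreover have "g \<bullet> (matrix_inv ?D *v ?x) = ?x \<bullet> (matrix_inv ?D *v g)"
    by (rule posdef_sym[OF posdef_inv[OF D]])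
  moreover have "laser_pred b c x y (Suc t) = ?x \<bullet> (matrix_inv ?D *v g)"
    by (simp add: laser_pred_def g_def)
  moreover have "laser_e b c x y (Suc t) = g + ?y *\<^sub>R ?x"
    by (simp add: g_def)
  moreover have "laser_f b c x y (Suc t) = laser_f b c x y t - inverse c * (?e \<bullet> g) + ?y\<^sup>2"
    by (simp add: g_def)
  \<comment> \<open>Expanding the quadratic form at \<open>g + ?y *\<^sub>R ?x\<close> produces
    twice \<open>?y\<close> times the prediction, the cross term of the squared loss. Its term in
    \<open>?y\<^sup>2\<close> is the extra term of the bound, and the first inequality supplies the
    squared prediction.\<close>
  ultimately show ?thesis
    unfolding optimal_cost_def
    by (simp add: matrix_vector_right_distrib matrix_vector_mult_scaleR inner_add_left
        inner_add_right power2_eq_square algebra_simps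
        del: laser_D.simps laser_e.simps laser_f.simps)
qed

lemma laser_loss_le_optimal_cost:
  assumes "0 < b" "b < c" and "\<forall>t\<in>{1..T}. \<bar>y t\<bar> \<le> Y"
  shows "laser_loss b c x y T \<le> optimal_cost b c x y T
    + Y\<^sup>2 * (\<Sum>t = 1..T. x t \<bullet> (matrix_inv (laser_D b c x t) *v x t))"
  using assms(3)
proof (induction T)
  case 0
  then show ?case by (simp add: laser_loss_def optimal_cost_def)
next
  case (Suc t)
  let ?q = "x (Suc t) \<bullet> (matrix_inv (laser_D b c x (Suc t)) *v x (Suc t))"
  have "?q \<ge> 0"
    by (intro posdef_nonneg posdef_inv laser_D_posdef assms(1,2))
  \<comment> \<open>\<open>Y\<close> is nonnegative because it bounds an absolute value.\<close>
  moreover have "(y (Suc t))\<^sup>2 \<le> Y\<^sup>2"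
    using Suc.prems by (intro power2_le_iff_abs_le[THEN iffD2] order_trans[OF abs_ge_zero]) auto
  ultimately have "(y (Suc t))\<^sup>2 * ?q \<le> Y\<^sup>2 * ?q"
    by (rule mult_right_mono[rotated])
  moreover have "laser_loss b c x y t \<le> optimal_cost b c x y t
    + Y\<^sup>2 * (\<Sum>t = 1..t. x t \<bullet> (matrix_inv (laser_D b c x t) *v x t))"
    using Suc by simp
  ultimately show ?case
    using laser_round_loss[OF assms(1,2), of y t x]
    by (simp add: laser_loss_def distrib_left del: laser_D.simps)
qed

text \<open>The minimum is expressed by a minimiser \<open>u\<close>, so that it is attained is part
  of the claim.\<close>

theorem theorem8:
  fixes x :: "nat \<Rightarrow> real ^ 'n" and y :: "nat \<Rightarrow> real"
    and b c Y :: real and T :: nat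
  assumes "0 < b" and "b < c"
    and "\<forall>t\<in>{1..T}. \<bar>y t\<bar> \<le> Y"
  shows "\<exists>u. (\<forall>v. comparator_cost b c x y T u \<le> comparator_cost b c x y T v)
    \<and> laser_loss b c x y T \<le> comparator_cost b c x y T u
        + Y\<^sup>2 * (\<Sum>t = 1..T. x t \<bullet> (matrix_inv (laser_D b c x t) *v x t))"
proof -
  obtain u where "comparator_cost b c x y T u = optimal_cost b c x y T"
    and "\<forall>v. optimal_cost b c x y T \<le> comparator_cost b c x y T v"
    using optimal_cost_attained[OF assms(1,2)] by blast
  with laser_loss_le_optimal_cost[OF assms, of x] show ?thesis
    by (intro exI[of _ u]) simp
qed

end
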